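(* Let $\mathbf{A}=[\underline{A},\overline{A}]$ be an $n\times n$ real interval matrix that is an inverse M-matrix. Then $\det(\mathbf{A})=[\det(A^1),\det(A^2)]$, where $A^1,A^2\in\mathbb{R}^{n\times n}$ are defined by $$A^1_{ij}=\begin{cases}\underline{A}_{ii}&\text{if }i=j,\\ \overline{A}_{ij}&\text{if }i\ne j,\end{cases}\qquad A^2_{ij}=\begin{cases}\overline{A}_{ii}&\text{if }i=j,\\ \underline{A}_{ij}&\text{if }i\ne j.\end{cases}$$
   Context: Inequalities between matrices are entrywise. For $\underline{A}\le\overline{A}$ in $\mathbb{R}^{n\times n}$, the interval matrix is $\mathbf{A}=\{A\in\mathbb{R}^{n\times n} : \underline{A}\le A\le\overline{A}\}$. A matrix $M\in\mathbb{R}^{n\times n}$ is an M-matrix if $m_{ij}\le 0$ for all $i\ne j$, $M$ is nonsingular, and $M^{-1}\ge 0$. A matrix $A$ is an inverse M-matrix if it is nonsingular and $A^{-1}$ is an M-matrix; $\mathbf{A}$ is an inverse M-matrix if every $A\in\mathbf{A}$ is. The range of the determinant is $\det(\mathbf{A})=\{\det(A) : A\in\mathbf{A}\}$. The superscripts in $A^1,A^2$ are indices, not powers. *)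

theory Defs
  imports "HOL-Analysis.Analysis"
begin

text \<open>
  The order on \<^typ>\<open>real ^ 'n ^ 'n\<close> is componentwise at both vector levels, so \<open>\<le>\<close> is the
  entrywise order and \<open>{L..U}\<close> is the interval matrix with bounds \<open>L\<close> and \<open>U\<close>.
\<close>

definition M_matrix :: "real ^ 'n ^ 'n \<Rightarrow> bool" where
  "M_matrix M \<longleftrightarrow>
     (\<forall>i j. i \<noteq> j \<longrightarrow> M $ i $ j \<le> 0) \<and> invertible M \<and> 0 \<le> matrix_inv M"

definition inverse_M_matrix :: "real ^ 'n ^ 'n \<Rightarrow> bool" where
  "inverse_M_matrix A \<longleftrightarrow> invertible A \<and> M_matrix (matrix_inv A)"

definition interval_inverse_M_matrix :: "(real ^ 'n ^ 'n) set \<Rightarrow> bool" where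
  "interval_inverse_M_matrix \<A> \<longleftrightarrow> (\<forall>A\<in>\<A>. inverse_M_matrix A)"

lemma entrywise_le_iff:
  fixes A B :: "real ^ 'n ^ 'n"
  shows "A \<le> B \<longleftrightarrow> (\<forall>i j. A $ i $ j \<le> B $ i $ j)"
  by (simp add: less_eq_vec_def)

end

theory Submission
  imports Defs
begin

text \<open>
  An M-matrix \<open>M\<close> has positive determinant: for the positive vector \<open>v = M\<^sup>-\<^sup>1 1\<close> every matrix
  \<open>N = (1 - s) I + s M\<close> on the segment from \<open>I\<close> to \<open>M\<close> satisfies \<open>N v > 0\<close>, hence is nonsingular,
  so the determinant keeps the sign it has at \<open>I\<close>. Consequently an inverse M-matrix \<open>A\<close> has
  \<open>det A > 0\<close>, and adding \<open>d\<close> to its \<open>k\<close>-th row changes the determinant by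
  \<open>det A * (\<Sum>j. d\<^sub>j (A\<^sup>-\<^sup>1)\<^sub>j\<^sub>k)\<close>. By the sign pattern of \<open>A\<^sup>-\<^sup>1\<close> the determinant is thus
  nondecreasing in the diagonal and nonincreasing in the off-diagonal entries. Replacing one row at
  a time stays inside the interval matrix, so \<open>A\<^sup>1\<close> and \<open>A\<^sup>2\<close> are extremal; the values in between
  are attained because the interval matrix is connected.
\<close>

lemma zero_le_matrix_iff:
  fixes M :: "real ^ 'n ^ 'm"
  shows "0 \<le> M \<longleftrightarrow> (\<forall>i j. 0 \<le> M $ i $ j)"
  by (simp add: less_eq_vec_def)

lemma matrix_mult_mat_1_nth:
  fixes M N :: "real ^ 'n ^ 'n"
  assumes "M ** N = mat 1"
  shows "(\<Sum>j\<in>UNIV. M $ i $ j * N $ j $ k) = (if i = k then 1 else 0)"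
proof -
  have "(M ** N) $ i $ k = (\<Sum>j\<in>UNIV. M $ i $ j * N $ j $ k)"
    by (simp add: matrix_matrix_mult_def)
  then show ?thesis using assms by (simp add: mat_def)
qed

lemma
  fixes A :: "real ^ 'n ^ 'n"
  assumes "invertible A"
  shows matrix_inv_right: "A ** matrix_inv A = mat 1"
    and matrix_inv_left: "matrix_inv A ** A = mat 1"
  using assms someI_ex[of "\<lambda>B. A ** B = mat 1 \<and> B ** A = mat 1"]
  unfolding invertible_def matrix_inv_def by blast+

lemma M_matrix_inverse:
  assumes "M_matrix M"
  shows "M ** matrix_inv M = mat 1" "matrix_inv M ** M = mat 1"
  using assms by (auto simp: M_matrix_def matrix_inv_right matrix_inv_left)

text \<open>In the diagonal entry \<open>(i, i)\<close> of \<open>M ** matrix_inv M = mat 1\<close>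
  every term with \<open>j \<noteq> i\<close> is nonpositive, so the term with \<open>j = i\<close>
  is at least 1.\<close>

lemma M_matrix_diag_pos:
  fixes M :: "real ^ 'n ^ 'n"
  assumes "M_matrix M"
  shows "0 < M $ i $ i"
proof -
  let ?N = "matrix_inv M"
  have nonneg: "0 \<le> ?N $ j $ k" for j k
    using assms by (simp add: M_matrix_def zero_le_matrix_iff)
  have off: "M $ i $ j * ?N $ j $ i \<le> 0" if "j \<noteq> i" for j
    using that assms nonneg[of j i] by (auto simp: M_matrix_def intro!: mult_nonpos_nonneg)
  have "1 = (\<Sum>j\<in>UNIV. M $ i $ j * ?N $ j $ i)"
    using matrix_mult_mat_1_nth[OF M_matrix_inverse(1)[OF assms], of i i] by simp
  also have "\<dots> = M $ i $ i * ?N $ i $ i + (\<Sum>j\<in>UNIV - {i}. M $ i $ j * ?N $ j $ i)"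
    by (simp add: sum.remove)
  also have "\<dots> \<le> M $ i $ i * ?N $ i $ i"
    using sum_nonpos[of "UNIV - {i}" "\<lambda>j. M $ i $ j * ?N $ j $ i"] off by simp
  finally have "0 < M $ i $ i * ?N $ i $ i" by linarith
  then show ?thesis using nonneg[of i i] by (simp add: zero_less_mult_iff)
qed

text \<open>A maximum principle: the row where the ratio of \<open>x\<close> to \<open>v\<close> is
  largest forces that ratio to be at most 0.\<close>

lemma semipositive_kernel_nonpos:
  fixes N :: "real ^ 'n ^ 'n" and v x :: "real ^ 'n"
  assumes off: "\<And>i j. i \<noteq> j \<Longrightarrow> N $ i $ j \<le> 0"
    and v: "\<And>i. 0 < v $ i" and Nv: "\<And>i. 0 < (N *v v) $ i"
    and Nx: "N *v x = 0"
  shows "x $ k \<le> 0"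
proof -
  let ?r = "\<lambda>i. x $ i / v $ i"
  \<comment> \<open>The least \<open>c\<close> with \<open>x \<le> c * v\<close> entrywise; equality
    holds at an index \<open>i\<close> attaining the maximum.\<close>
  define c where "c = Max (range ?r)"
  have "c \<in> range ?r"
    unfolding c_def by (rule Max_in) auto
  then obtain i where i: "c = ?r i" by blast
  have le: "x $ j \<le> c * v $ j" for j
  proof -
    have "?r j \<le> c" unfolding c_def by (rule Max_ge) auto
    then show ?thesis using v[of j] by (simp add: pos_divide_le_eq)
  qed
  have eq: "x $ i = c * v $ i"
    using v[of i] by (simp add: i)
  have "c * (N *v v) $ i = (\<Sum>j\<in>UNIV. N $ i $ j * (c * v $ j))"
    by (simp add: matrix_vector_mult_def sum_distrib_left mult_ac)
  \<comment> \<open>Off the diagonal the nonpositive entries of \<open>N\<close> reverse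
    \<open>x $ j \<le> c * v $ j\<close>; at \<open>j = i\<close> both sides agree.\<close>
  also have "\<dots> \<le> (\<Sum>j\<in>UNIV. N $ i $ j * x $ j)"
  proof (rule sum_mono)
    fix j show "N $ i $ j * (c * v $ j) \<le> N $ i $ j * x $ j"
      using off[of i j] le[of j] eq by (cases "j = i") (auto intro: mult_left_mono_neg)
  qed
  also have "\<dots> = (N *v x) $ i" by (simp add: matrix_vector_mult_def)
  also have "\<dots> = 0" using Nx by simp
  finally have "c \<le> 0" using Nv[of i] by (simp add: mult_le_0_iff)
  then have "c * v $ k \<le> 0" using v[of k] by (simp add: mult_nonpos_nonneg less_imp_le)
  then show ?thesis using le[of k] by linarith
qed

text \<open>The kernel is closed under negation, so the one-sided bound applied to \<open>x\<close>
  and \<open>- x\<close> makes it trivial.\<close>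

lemma semipositive_det_nonzero:
  fixes N :: "real ^ 'n ^ 'n"
  assumes "\<And>i j. i \<noteq> j \<Longrightarrow> N $ i $ j \<le> 0"
    and "\<And>i. 0 < v $ i" and "\<And>i. 0 < (N *v v) $ i"
  shows "det N \<noteq> 0"
proof -
  have "x = 0" if "N *v x = 0" for x
  proof -
    have "N *v (- x) = 0"
      using that by (simp add: matrix_vector_mult_def vec_eq_iff sum_negf)
    then have "(- x) $ k \<le> 0" "x $ k \<le> 0" for k
      using semipositive_kernel_nonpos[OF assms] that by blast+
    then show ?thesis by (simp add: vec_eq_iff antisym)
  qed
  then show ?thesis
    by (metis invertible_det_nz invertible_left_inverse matrix_left_invertible_ker)
qed

lemma continuous_on_det:
  fixes f :: "'a::topological_space \<Rightarrow> real ^ 'n ^ 'n"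
  assumes "continuous_on S f"
  shows "continuous_on S (\<lambda>x. det (f x))"
  unfolding det_def by (intro continuous_intros assms)

lemma M_matrix_det_pos:
  fixes M :: "real ^ 'n ^ 'n"
  assumes "M_matrix M"
  shows "0 < det M"
proof -
  let ?N = "matrix_inv M"
  define v where "v = ?N *v 1"
  have nonneg: "0 \<le> ?N $ j $ k" for j k
    using assms by (simp add: M_matrix_def zero_le_matrix_iff)
  have v: "0 < v $ i" for i
  proof -
    have "v $ i = (\<Sum>j\<in>UNIV. ?N $ i $ j)"
      by (simp add: v_def matrix_vector_mult_def)
    \<comment> \<open>A zero row \<open>i\<close> of the inverse would make entry
      \<open>(i, i)\<close> of \<open>matrix_inv M ** M\<close> vanish.\<close>
    moreover have "\<exists>j. ?N $ i $ j \<noteq> 0"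
    proof (rule ccontr)
      assume "\<nexists>j. ?N $ i $ j \<noteq> 0"
      then show False
        using matrix_mult_mat_1_nth[OF M_matrix_inverse(2)[OF assms], of i i] by simp
    qed
    ultimately show ?thesis
      using nonneg by (metis UNIV_I finite order_less_le sum_pos2)
  qed
  have Mv: "M *v v = 1"
    by (simp add: v_def matrix_vector_mul_assoc M_matrix_inverse[OF assms])
  define h where "h s = (\<chi> i j. (1 - s) * (mat 1 :: real^'n^'n) $ i $ j + s * M $ i $ j)" for s :: real
  have nz: "det (h s) \<noteq> 0" if "s \<in> {0..1}" for s
  proof (rule semipositive_det_nonzero)
    show "h s $ i $ j \<le> 0" if "i \<noteq> j" for i j
      using that \<open>s \<in> {0..1}\<close> assms by (simp add: h_def mat_def M_matrix_def mult_nonneg_nonpos)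
    show "0 < v $ i" for i by (rule v)
    show "0 < (h s *v v) $ i" for i
    proof -
      have "(h s *v v) $ i = (1 - s) * (mat 1 *v v) $ i + s * (M *v v) $ i"
        unfolding h_def matrix_vector_mult_def
        by (simp add: sum_distrib_left distrib_right sum.distrib mult.assoc)
      also have "\<dots> = (1 - s) * v $ i + s" by (simp add: Mv)
      also have "\<dots> > 0"
        using that v[of i] by (cases "s = 0") (auto intro!: add_nonneg_pos)
      finally show ?thesis .
    qed
  qed
  have cont: "continuous_on {0..1} (\<lambda>s. det (h s))"
    unfolding h_def by (intro continuous_on_det continuous_intros)
  have h01: "h 0 = mat 1" "h 1 = M" by (simp_all add: h_def vec_eq_iff)
  show ?thesis
  proof (rule ccontr)
    assume "\<not> ?thesis"
    \<comment> \<open>The determinant is 1 at \<open>s = 0\<close> and assumed nonpositive at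
      \<open>s = 1\<close>, so it has a zero in between.\<close>
    then obtain s where "0 \<le> s" "s \<le> 1" "det (h s) = 0"
      using IVT2'[of "\<lambda>s. det (h s)" 1 0 0, OF _ _ _ cont] h01 by auto
    then show False using nz[of s] by simp
  qed
qed

lemma inverse_M_matrix_det_pos:
  assumes "inverse_M_matrix A"
  shows "0 < det A"
proof -
  have "A ** matrix_inv A = mat 1" and "0 < det (matrix_inv A)"
    using assms by (auto simp: inverse_M_matrix_def matrix_inv_right M_matrix_det_pos)
  moreover from this(1) have "det A * det (matrix_inv A) = 1"
    by (metis det_I det_mul)
  ultimately show ?thesis by (metis zero_less_mult_pos2 zero_less_one)
qed

text \<open>Cramer's rule for rows: \<open>d v* matrix_inv A\<close> lists the coefficients of
  \<open>d\<close> as a combination of the rows of \<open>A\<close>.\<close>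

lemma det_replace_row:
  fixes A :: "real ^ 'n ^ 'n"
  assumes "invertible A"
  shows "det (\<chi> i. if i = k then d else row i A) = (d v* matrix_inv A) $ k * det A"
proof -
  have "(\<Sum>i\<in>UNIV. (d v* matrix_inv A) $ i *s row i A) = (d v* matrix_inv A) v* A"
    by (simp add: vec_eq_iff vector_matrix_mult_def row_def mult.commute)
  also have "\<dots> = d"
    using assms by (simp add: vector_matrix_mul_assoc matrix_inv_left)
  finally show ?thesis
    using cramer_lemma_transpose[where x = "d v* matrix_inv A" and A = A and k = k]
    by (simp only:)
qed

text \<open>The determinant is linear in row \<open>k\<close>, so the change is exact, with no
  derivative or path between \<open>A\<close> and \<open>B\<close>.\<close>

lemma det_mono_row:
  fixes A B :: "real ^ 'n ^ 'n"
  assumes A: "inverse_M_matrix A"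
    and rows: "\<And>i. i \<noteq> k \<Longrightarrow> B $ i = A $ i"
    and diag: "A $ k $ k \<le> B $ k $ k"
    and off: "\<And>j. j \<noteq> k \<Longrightarrow> B $ k $ j \<le> A $ k $ j"
  shows "det A \<le> det B"
proof -
  let ?M = "matrix_inv A" and ?d = "B $ k - A $ k"
  have M: "M_matrix ?M" and inv: "invertible A"
    using A by (auto simp: inverse_M_matrix_def)
  have "B = (\<chi> i. if i = k then A $ k + ?d else row i A)"
    using rows by (simp add: vec_eq_iff row_def)
  then have "det B = det (\<chi> i. if i = k then A $ k else row i A)
      + det (\<chi> i. if i = k then ?d else row i A)"
    using det_row_add[of k "\<lambda>_. A $ k" "\<lambda>_. ?d" "\<lambda>i. row i A"] by (simp only:)
  also have "(\<chi> i. if i = k then A $ k else row i A) = A"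
    by (simp add: vec_eq_iff row_def)
  finally have "det B = det A + (?d v* ?M) $ k * det A"
    by (simp add: det_replace_row[OF inv])
  moreover have "0 \<le> (?d v* ?M) $ k"
  proof -
    \<comment> \<open>Both factors are nonnegative for \<open>j = k\<close> and nonpositive
      otherwise.\<close>
    have "0 \<le> ?M $ j $ k * ?d $ j" for j
      using M_matrix_diag_pos[OF M, of k] diag off[of j] M
      by (cases "j = k") (auto simp: M_matrix_def intro: mult_nonpos_nonpos)
    then show ?thesis
      by (simp add: vector_matrix_mult_def sum_nonneg mult.commute)
  qed
  ultimately show ?thesis
    using inverse_M_matrix_det_pos[OF A] by simp
qed

lemma det_mono_interval:
  fixes L U A B :: "real ^ 'n ^ 'n"
  assumes inv: "interval_inverse_M_matrix {L..U}"
    and A: "A \<in> {L..U}" and B: "B \<in> {L..U}"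
    and diag: "\<And>i. A $ i $ i \<le> B $ i $ i"
    and off: "\<And>i j. i \<noteq> j \<Longrightarrow> B $ i $ j \<le> A $ i $ j"
  shows "det A \<le> det B"
proof -
  \<comment> \<open>Hybrids with the rows in \<open>S\<close> from \<open>B\<close> and the others
    from \<open>A\<close>: they lie in \<open>{L..U}\<close>, so each one-row exchange starts from
    an inverse M-matrix.\<close>
  define C where "C S = (\<chi> i. if i \<in> S then B $ i else A $ i)" for S
  have C: "inverse_M_matrix (C S)" for S
    using inv A B by (auto simp: interval_inverse_M_matrix_def C_def less_eq_vec_def)
  have "det A \<le> det (C S)" if "finite S" for S
    using that
  proof induction
    case empty
    show ?case by (simp add: C_def)
  next
    case (insert k S)
    have "det (C S) \<le> det (C (insert k S))"
      by (rule det_mono_row[where k = k, OF C])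
        (use insert.hyps diag off in \<open>auto simp: C_def\<close>)
    then show ?case using insert.IH by linarith
  qed
  then have "det A \<le> det (C UNIV)" by simp
  then show ?thesis by (simp add: C_def)
qed

theorem theorem26:
  fixes L U A1 A2 :: "real ^ 'n ^ 'n"
  assumes "L \<le> U"
    and "interval_inverse_M_matrix {L..U}"
    and "A1 = (\<chi> i j. if i = j then L $ i $ i else U $ i $ j)"
    and "A2 = (\<chi> i j. if i = j then U $ i $ i else L $ i $ j)"
  shows "det ` {L..U} = {det A1..det A2}"
proof
  have A12: "A1 \<in> {L..U}" "A2 \<in> {L..U}"
    using assms(1) by (auto simp: assms(3,4) less_eq_vec_def)
  show "det ` {L..U} \<subseteq> {det A1..det A2}"
  proof clarify
    fix A assume A: "A \<in> {L..U}"
    have "det A1 \<le> det A"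
      by (rule det_mono_interval[OF assms(2) A12(1) A])
        (use A in \<open>auto simp: assms(3) less_eq_vec_def\<close>)
    moreover have "det A \<le> det A2"
      by (rule det_mono_interval[OF assms(2) A A12(2)])
        (use A in \<open>auto simp: assms(4) less_eq_vec_def\<close>)
    ultimately show "det A \<in> {det A1..det A2}" by simp
  qed
  \<comment> \<open>A connected set of reals containing both extremal determinants contains the
    whole interval between them.\<close>
  have "connected {L..U}"
    by (simp add: convex_connected)
  then have "connected (det ` {L..U})"
    by (intro connected_continuous_image continuous_on_det continuous_on_id)
  then show "{det A1..det A2} \<subseteq> det ` {L..U}"
    using A12 by (meson connected_contains_Icc imageI)
qed

end
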